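(* Let $R$ be a commutative ring with identity, $n\in\mathbb{Z}^+$, and let $X\subseteq R^n$ be infinite. Then the evaluation map $E_X:R[t_1,\ldots,t_n]\to R^X$, $f\mapsto(x\mapsto f(x))$, is not surjective.
   Context: $R^X$ denotes the $R$-algebra of all functions $X\to R$ with pointwise operations. *)

theory Defs
  imports
    "HOL-Library.FuncSet"
    "HOL-Library.Poly_Mapping"
    "HOL-Analysis.Finite_Cartesian_Product"
begin

text \<open>
  Exponent vectors are finitely supported functions from the variables to the naturals, and
  polynomials are finitely supported functions from exponent vectors to coefficients, so that the
  multiplication provided by the library is the usual (convolution) product.  With a finite index
  type \<open>'n\<close>, the type \<open>('a, 'n) poly_ring\<close> is the polynomial ring in \<open>CARD('n)\<close> variables, and
  \<open>CARD('n)\<close> is an arbitrary positive integer.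
\<close>

type_synonym ('a, 'n) poly_ring = "('n \<Rightarrow>\<^sub>0 nat) \<Rightarrow>\<^sub>0 'a"

definition poly_eval :: "('a::comm_ring_1, 'n::finite) poly_ring \<Rightarrow> 'a ^ 'n \<Rightarrow> 'a" where
  "poly_eval f x =
     (\<Sum>m\<in>Poly_Mapping.keys f.
        Poly_Mapping.lookup f m * (\<Prod>i\<in>UNIV. (x $ i) ^ Poly_Mapping.lookup m i))"

text \<open>
  Functions from \<open>X\<close> to the ring are represented by the extensional functions
  \<open>X \<rightarrow>\<^sub>E UNIV\<close>, which take a fixed default value outside \<open>X\<close>.
\<close>

definition fun_ring :: "('a::comm_ring_1 ^ 'n::finite) set \<Rightarrow> ('a ^ 'n \<Rightarrow> 'a) set" where
  "fun_ring X = X \<rightarrow>\<^sub>E UNIV"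

definition eval_map ::
  "('a::comm_ring_1 ^ 'n::finite) set \<Rightarrow> ('a, 'n) poly_ring \<Rightarrow> ('a ^ 'n \<Rightarrow> 'a)" where
  "eval_map X f = (\<lambda>x\<in>X. poly_eval f x)"

lemma eval_map_in_fun_ring: "eval_map X f \<in> fun_ring X"
  by (simp add: eval_map_def fun_ring_def)

end

theory Submission
  imports Defs "Jordan_Normal_Form.Determinant"
begin

text \<open>
  A polynomial only involves finitely many of the countably many monomials.  For every \<open>d\<close>, the
  first \<open>d\<close> monomials cannot interpolate arbitrary values on \<open>d + 1\<close> points, because there is no
  surjection \<open>R\<^sup>d \<rightarrow> R\<^sup>d\<^sup>+\<^sup>1\<close> over a nontrivial commutative ring.  Choosing
  disjoint blocks of \<open>d + 1\<close> points of \<open>X\<close>, one for each \<open>d\<close>, and on each block a function that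
  is not interpolated there, yields a function on \<open>X\<close> that no polynomial represents.
\<close>

text \<open>Solutions for all unit vectors would factor the identity of size \<open>n + 1\<close>
  through \<open>n\<close> coordinates. Determinants exclude this over any commutative ring with
  \<open>0 \<noteq> 1\<close>, without a notion of dimension.\<close>

lemma underdetermined_range:
  fixes A :: "nat \<Rightarrow> nat \<Rightarrow> 'a::comm_ring_1"
  shows "\<exists>h. \<forall>c. \<exists>i\<le>n. h i \<noteq> (\<Sum>k<n. A i k * c k)"
proof (rule ccontr)
  assume "\<not> ?thesis"
  then have "\<forall>h. \<exists>c. \<forall>i\<le>n. h i = (\<Sum>k<n. A i k * c k)"
    by blast
  then have "\<forall>j. \<exists>c. \<forall>i\<le>n. of_bool (i = j) = (\<Sum>k<n. A i k * c k)"
    by (intro allI) (erule allE)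
  then obtain C where C: "\<And>i j. i \<le> n \<Longrightarrow> of_bool (i = j) = (\<Sum>k<n. A i k * C j k)"
    by metis
  \<comment> \<open>Pad the two rectangular factors of the identity with a zero column to make them square.\<close>
  define P where "P = mat (Suc n) (Suc n) (\<lambda>(i, k). if k < n then A i k else 0)"
  define Q where "Q = mat (Suc n) (Suc n) (\<lambda>(k, j). C j k)"
  have PQ: "P \<in> carrier_mat (Suc n) (Suc n)" "Q \<in> carrier_mat (Suc n) (Suc n)"
    by (simp_all add: P_def Q_def)
  have "P * Q = 1\<^sub>m (Suc n)"
  proof (rule eq_matI)
    fix i j assume "i < dim_row (1\<^sub>m (Suc n) :: 'a mat)" "j < dim_col (1\<^sub>m (Suc n) :: 'a mat)"
    then have ij: "i \<le> n" "j \<le> n" by auto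
    then have "(P * Q) $$ (i, j) = (\<Sum>k<Suc n. (if k < n then A i k else 0) * C j k)"
      by (simp add: P_def Q_def scalar_prod_def lessThan_atLeast0)
    also have "\<dots> = of_bool (i = j)"
      using ij by (simp add: C)
    finally show "(P * Q) $$ (i, j) = 1\<^sub>m (Suc n) $$ (i, j)"
      using ij by simp
  qed (use PQ in auto)
  then have "det P * det Q = 1"
    using det_mult[OF PQ] by simp
  moreover have "det P = 0"
    using laplace_expansion_column[OF PQ(1), of n] by (simp add: P_def)
  ultimately show False by simp
qed

lemma countable_family_not_spanning:
  fixes \<phi> :: "'k::countable \<Rightarrow> 'b \<Rightarrow> 'a::comm_ring_1"
  assumes "infinite X"
  shows "\<exists>g. \<forall>F c. finite F \<longrightarrow> (\<exists>x\<in>X. g x \<noteq> (\<Sum>k\<in>F. \<phi> k x * c k))"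
proof -
  obtain p :: "nat \<Rightarrow> 'b" where p: "inj p" "range p \<subseteq> X"
    using assms infinite_countable_subset by blast
  \<comment> \<open>Block \<open>d\<close> is an infinite row of the pairing; only its entries with
    \<open>i \<le> d\<close> are needed.\<close>
  define q where "q d i = p (prod_encode (d, i))" for d i
  have "\<forall>d. \<exists>h. \<forall>c. \<exists>i\<le>d. h i \<noteq> (\<Sum>k<d. \<phi> (from_nat k) (q d i) * c k)"
    by (intro allI underdetermined_range)
  then obtain h
    where h: "\<And>d c. \<exists>i\<le>d. h d i \<noteq> (\<Sum>k<d. \<phi> (from_nat k) (q d i) * c k)"
    by metis
  define g where "g x = (case prod_decode (inv_into UNIV p x) of (d, i) \<Rightarrow> h d i)" for x
  have g: "g (q d i) = h d i" for d i
    by (simp add: g_def q_def p)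
  have "\<exists>x\<in>X. g x \<noteq> (\<Sum>k\<in>F. \<phi> k x * c k)" if "finite F" for F c
  proof -
    obtain d where d: "to_nat ` F \<subseteq> {..<d}"
      using \<open>finite F\<close> finite_nat_iff_bounded by blast
    \<comment> \<open>Codes outside the image of \<open>F\<close> get coefficient 0, since
      \<open>from_nat\<close> may send them anywhere, even into \<open>F\<close>.\<close>
    define c' where "c' k = (if k \<in> to_nat ` F then c (from_nat k) else 0)" for k
    have "(\<Sum>k\<in>F. \<phi> k x * c k) = (\<Sum>k<d. \<phi> (from_nat k) x * c' k)" for x
    proof -
      have "(\<Sum>k\<in>F. \<phi> k x * c k) = (\<Sum>k\<in>to_nat ` F. \<phi> (from_nat k) x * c' k)"
        by (simp add: sum.reindex inj_on_def c'_def)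
      also have "\<dots> = (\<Sum>k<d. \<phi> (from_nat k) x * c' k)"
        by (rule sum.mono_neutral_left) (use d in \<open>auto simp: c'_def\<close>)
      finally show ?thesis .
    qed
    moreover have "q d i \<in> X" for i
      using p by (auto simp: q_def)
    ultimately show ?thesis
      using h[of d c'] g by metis
  qed
  then show ?thesis by blast
qed

text \<open>Indexing monomials by plain functions \<open>'n \<Rightarrow> nat\<close>, a countable
  type as \<open>'n\<close> is finite, fits \<open>countable_family_not_spanning\<close>;
  \<open>Abs_poly_mapping\<close> recovers the exponent vector.\<close>

lemma poly_eval_eq_sum_exponents:
  "poly_eval f x = (\<Sum>u\<in>Poly_Mapping.lookup ` Poly_Mapping.keys f.
     (\<Prod>i\<in>UNIV. vec_nth x i ^ u i) * Poly_Mapping.lookup f (Abs_poly_mapping u))"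
  by (simp add: poly_eval_def sum.reindex inj_on_def poly_mapping_eqI mult.commute)

theorem theorem20:
  fixes X :: "('a::comm_ring_1 ^ 'n::finite) set"
  assumes "infinite X"
  shows "eval_map X ` (UNIV :: ('a, 'n) poly_ring set) \<noteq> fun_ring X"
proof
  assume surj: "eval_map X ` (UNIV :: ('a, 'n) poly_ring set) = fun_ring X"
  obtain g where g: "\<And>F c. finite F \<Longrightarrow>
      \<exists>x\<in>X. g x \<noteq> (\<Sum>u\<in>F. (\<Prod>i\<in>UNIV. vec_nth x i ^ u i) * c u)"
    using countable_family_not_spanning
      [OF assms, of "\<lambda>(u :: 'n \<Rightarrow> nat) x. \<Prod>i\<in>UNIV. vec_nth x i ^ u i"] by blast
  have "restrict g X \<in> fun_ring X"
    by (simp add: fun_ring_def)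
  then obtain f :: "('a, 'n) poly_ring" where f: "restrict g X = eval_map X f"
    using surj by blast
  have "g x = poly_eval f x" if "x \<in> X" for x
    using fun_cong[OF f, of x] that by (simp add: eval_map_def)
  then show False
    using g[of "Poly_Mapping.lookup ` Poly_Mapping.keys f"
        "\<lambda>u. Poly_Mapping.lookup f (Abs_poly_mapping u)"]
    by (auto simp: poly_eval_eq_sum_exponents)
qed

end
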